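(* Let $q$ be a prime power, let $n$ and $m\ge3$ be positive integers, and let $I,J$ be nonnegative integers with $I<J<n/2$ and $\gcd(I,J)=1$; put $K:=J-I$. Let $\mathbf{A}=(\alpha_1,\dots,\alpha_m)$ and $\overline{\mathbf{A}}=(\overline{\alpha_1},\dots,\overline{\alpha_m})$ with all entries in $\mathbb{F}_{q^n}^*$. For a field automorphism $\sigma$ of $\mathbb{F}_{q^n}$ and $\delta\in\{1,\dots,m\}$ let $$C_\delta:=\prod_{j=0}^{m-1}\left(\frac{\overline{\alpha_{\delta+1+j}}}{\alpha_{2+j}^{\sigma}}\right)^{q^{jK}},$$ with indices taken modulo $m$ in $\{1,\dots,m\}$ (so e.g. $C_1=\left(\frac{\overline{\alpha_2}}{\alpha_2^\sigma}\right)\left(\frac{\overline{\alpha_3}}{\alpha_3^\sigma}\right)^{q^K}\cdots\left(\frac{\overline{\alpha_m}}{\alpha_m^\sigma}\right)^{q^{(m-2)K}}\left(\frac{\overline{\alpha_1}}{\alpha_1^\sigma}\right)^{q^{(m-1)K}}$). Then $U^{I,J}_{\mathbf{A}}$ and $U^{I,J}_{\overline{\mathbf{A}}}$ are $\Gamma\mathrm{L}(2m,q^n)$-equivalent if and only if there exists a field automorphism $\sigma$ of $\mathbb{F}_{q^n}$ such that at least one of $C_1,\dots,C_m$ is a $(q^{mK}-1)$-power in $\mathbb{F}_{q^n}$.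
   Context: An element $a$ of a field $F$ is a $d$-power in $F$ if $a=y^d$ for some $y\in F$. For $\mathbf{A}=(\alpha_1,\dots,\alpha_m)\in(\mathbb{F}_{q^n}^* )^m$, $U^{I,J}_{\mathbf{A}}:=\{(x_1,\dots,x_m,f_1(\underline{x}),\dots,f_m(\underline{x})): x_1,\dots,x_m\in\mathbb{F}_{q^n}\}\subseteq\mathbb{F}_{q^n}^{2m}$, where $f_i(\underline{x})=x_i^{q^I}+\alpha_{i+1}x_{i+1}^{q^J}$ for $i=1,\dots,m-1$ and $f_m(\underline{x})=x_m^{q^I}+\alpha_1x_1^{q^J}$. Two $\mathbb{F}_q$-subspaces $U,U'\subseteq\mathbb{F}_{q^n}^{2m}$ are $\Gamma\mathrm{L}(2m,q^n)$-equivalent if there exist $M\in\mathrm{GL}(2m,q^n)$ and a field automorphism $\sigma$ of $\mathbb{F}_{q^n}$ such that $U'=\{Mv^\sigma: v\in U\}$, with $\sigma$ acting entrywise.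
   Formalization: The formal theorem assumes I > 0; for I = 0, J = 1 the statement fails (all U_A are then equivalent, yet for q = 2, n = m = 3, A = (1,1,1), Ā = (g,1,1) with g ≠ 0, 1 no C_δ is a 7th power in F_8). *)

theory Defs
  imports
    "HOL-Library.Cardinality"
    "HOL-Number_Theory.Prime_Powers"
    "HOL-Computational_Algebra.Nth_Powers"
    "Jordan_Normal_Form.Matrix"
begin

text \<open>
  The field with \<open>q ^ n\<close> elements is a type \<open>'a :: {field, finite}\<close> with \<open>CARD('a) = q ^ n\<close>.
  Tuples such as \<open>(\<alpha>\<^sub>1, \<dots>, \<alpha>\<^sub>m)\<close> are functions on \<open>nat\<close>, of which only the values
  at \<open>1, \<dots>, m\<close> are used.
\<close>

text \<open>Reduction of an index \<open>k \<ge> 1\<close> modulo \<open>m\<close> with representatives in \<open>{1..m}\<close>.\<close>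

definition cyc :: "nat \<Rightarrow> nat \<Rightarrow> nat" where
  "cyc m k = (k - 1) mod m + 1"

definition field_automorphism :: "('a::field \<Rightarrow> 'a) \<Rightarrow> bool" where
  "field_automorphism \<sigma> \<longleftrightarrow> field_hom \<sigma> \<and> bij \<sigma>"

definition f_comp :: "nat \<Rightarrow> nat \<Rightarrow> nat \<Rightarrow> nat \<Rightarrow> (nat \<Rightarrow> 'a::field) \<Rightarrow> (nat \<Rightarrow> 'a) \<Rightarrow> nat \<Rightarrow> 'a" where
  "f_comp q m I J \<alpha> x i =
     x i ^ (q ^ I) + \<alpha> (cyc m (i + 1)) * x (cyc m (i + 1)) ^ (q ^ J)"

text \<open>
  Coordinates of \<open>vec\<close> start at \<open>0\<close>, hence the shift. The vectors have dimension \<open>m + m = 2 * m\<close>.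
\<close>

definition U_space :: "nat \<Rightarrow> nat \<Rightarrow> nat \<Rightarrow> nat \<Rightarrow> (nat \<Rightarrow> 'a::field) \<Rightarrow> 'a vec set" where
  "U_space q m I J \<alpha> =
     {vec m (\<lambda>k. x (k + 1)) @\<^sub>v vec m (\<lambda>k. f_comp q m I J \<alpha> x (k + 1)) | x :: nat \<Rightarrow> 'a. True}"

definition GammaL_equiv :: "nat \<Rightarrow> 'a::field vec set \<Rightarrow> 'a vec set \<Rightarrow> bool" where
  "GammaL_equiv d U U' \<longleftrightarrow>
     (\<exists>M \<sigma>. M \<in> carrier_mat d d \<and> invertible_mat M \<and> field_automorphism \<sigma> \<and>
            U' = {M *\<^sub>v map_vec \<sigma> v | v. v \<in> U})"

definition C_coeff ::
  "nat \<Rightarrow> nat \<Rightarrow> nat \<Rightarrow> (nat \<Rightarrow> 'a::field) \<Rightarrow> (nat \<Rightarrow> 'a) \<Rightarrow> ('a \<Rightarrow> 'a) \<Rightarrow> nat \<Rightarrow> 'a" where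
  "C_coeff q m K \<alpha> \<alpha>' \<sigma> \<delta> =
     (\<Prod>j<m. (\<alpha>' (cyc m (\<delta> + 1 + j)) / \<sigma> (\<alpha> (cyc m (2 + j)))) ^ (q ^ (j * K)))"

text \<open>
  The equivalence criterion is stated for \<open>I > 0\<close>; it fails for \<open>I = 0\<close> (so \<open>J = 1\<close>). There
  the coordinates \<open>x\<^sub>i + \<alpha>\<^bsub>i+1\<^esub> x\<^bsub>i+1\<^esub> ^ q\<close> contain the linear terms \<open>x\<^sub>i\<close>, and
  subtracting these, rescaling and adding them back is an element of the general linear group
  mapping any \<open>U_space q m 0 1 \<alpha>\<close> onto any other \<open>U_space q m 0 1 \<alpha>'\<close>. But for
  \<open>q = 2\<close>, \<open>n = m = 3\<close>, \<open>\<alpha> = (1, 1, 1)\<close> and \<open>\<alpha>' = (g, 1, 1)\<close> with \<open>g \<noteq> 0, 1\<close>, every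
  \<open>C_coeff\<close> is of the form \<open>g ^ (2 ^ j)\<close>, hence different from \<open>0\<close> and \<open>1\<close>, the only
  7th powers in the field with 8 elements.
\<close>

end

theory Submission
  imports Defs "HOL-Number_Theory.Residues" "Jordan_Normal_Form.Determinant"
begin

text \<open>
  After replacing \<open>\<alpha>\<close> by \<open>\<sigma> \<circ> \<alpha>\<close> one may take \<open>\<sigma> = id\<close>. Write the equivalence as a block matrix with
  rows \<open>(P, Q)\<close> and \<open>(R, S)\<close> and substitute \<open>x = t e\<^sub>k\<close>. Since \<open>2J < n\<close>, the coefficients of the
  resulting \<open>q\<close>-polynomials in \<open>t\<close> can be compared: the exponent \<open>2J\<close> occurs only once and gives
  \<open>Q = 0\<close>; the exponents \<open>I\<close> and \<open>J\<close> then give \<open>S\<^bsub>ik\<^esub> = P\<^bsub>ik\<^esub> ^ (q ^ I)\<close> and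
  \<open>\<alpha>'\<^bsub>i+1\<^esub> P\<^bsub>i+1,k+1\<^esub> ^ (q ^ J) = \<alpha>\<^bsub>k+1\<^esub> P\<^bsub>ik\<^esub> ^ (q ^ I)\<close>. These equations decouple along the cyclic
  diagonals of \<open>P\<close>, so a nonzero diagonal has no zero entries and by itself yields a monomial
  equivalence. Going once around it, the values \<open>r\<^sub>j = p\<^sub>j ^ (q ^ I)\<close> telescope to
  \<open>C\<^sub>\<delta> r\<^sub>0 ^ (q ^ (mK) - 1) = 1\<close>, and conversely such an \<open>r\<^sub>0\<close> determines the diagonal.
\<close>

subsection \<open>Linearized polynomials over finite fields\<close>

lemma frobenius_add:
  fixes x y :: "'a :: {field, finite}"
  assumes "primepow q" and "CARD('a) = q ^ n"
  shows "(x + y) ^ (q ^ i) = x ^ (q ^ i) + y ^ (q ^ i)"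
proof -
  obtain p k where p: "prime p" "k > 0" "q = p ^ k"
    using assms(1) by (auto simp: primepow_def)
  have char: "prime CHAR('a)"
    using finite_imp_CHAR_pos[where 'a = 'a] prime_CHAR_semidom[where 'a = 'a] by simp
  have "CHAR('a) dvd p ^ (k * n)"
    using CHAR_dvd_CARD[where 'a = 'a] assms(2) p(3) by (simp add: power_mult)
  hence "CHAR('a) = p"
    using char p(1) by (metis prime_dvd_power primes_dvd_imp_eq)
  hence "q ^ i = CHAR('a) ^ (k * i)"
    by (simp add: p(3) power_mult)
  from freshmans_dream'[OF char this] show ?thesis .
qed

text \<open>Additivity gives injectivity, hence surjectivity on a finite field. The resulting
  \<open>q ^ I\<close>-th roots later recover a diagonal \<open>p\<close> from its powers
  \<open>r\<close>.\<close>

lemma frobenius_surj: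
  assumes "primepow q" and "CARD('a :: {field, finite}) = q ^ n"
  shows "surj (\<lambda>x::'a. x ^ (q ^ i))"
proof -
  have "inj (\<lambda>x::'a. x ^ (q ^ i))"
  proof (rule injI)
    fix x y :: 'a
    assume *: "x ^ (q ^ i) = y ^ (q ^ i)"
    have "x ^ (q ^ i) = (x - y) ^ (q ^ i) + y ^ (q ^ i)"
      using frobenius_add[OF assms, of "x - y" y i] by simp
    with * show "x = y" by simp
  qed
  thus ?thesis
    by (rule finite_UNIV_inj_surj[OF finite])
qed

text \<open>A nonzero polynomial of degree at most \<open>q ^ (n - 1)\<close> cannot vanish at all
  \<open>q ^ n\<close> field elements, and the exponents \<open>q ^ e\<close> are distinct.\<close>

lemma linearized_poly_eq_0_imp_coeff_eq_0:
  fixes c :: "nat \<Rightarrow> 'a :: {field, finite}"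
  assumes q: "q > 1" and card: "CARD('a) = q ^ n"
    and zero: "\<And>t. (\<Sum>e<n. c e * t ^ (q ^ e)) = 0"
    and "e < n"
  shows "c e = 0"
proof -
  define p where "p = (\<Sum>e<n. monom (c e) (q ^ e))"
  have "degree p \<le> q ^ (n - 1)"
    unfolding p_def
    by (intro degree_sum_le order.trans[OF degree_monom_le] power_increasing) (use q in auto)
  also have "\<dots> < q ^ n"
    using q \<open>e < n\<close> by (intro power_strict_increasing) auto
  finally have "p = 0"
    using zero q by (intro poly_eqI_degree[of UNIV]) (auto simp: p_def poly_sum poly_monom card)
  hence "0 = coeff p (q ^ e)" by simp
  also have "\<dots> = (\<Sum>i<n. if i = e then c i else 0)"
    using q by (auto simp: p_def coeff_sum intro!: sum.cong)
  also have "\<dots> = c e"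
    using \<open>e < n\<close> by simp
  finally show ?thesis by simp
qed

text \<open>All six exponents lie below \<open>n\<close>, and \<open>2 * J\<close> exceeds the
  others. The only possible coincidence is \<open>2 * I = J\<close>, so the coefficient at
  \<open>J\<close> is isolated once \<open>a3 = 0\<close>.\<close>

lemma linearized_six_terms:
  fixes a0 a1 a2 a3 a4 a5 :: "'a :: {field, finite}"
  assumes q: "q > 1" and card: "CARD('a) = q ^ n"
    and "0 < I" "I < J" "2 * J < n"
    and zero: "\<And>t. a0 * t + a1 * t ^ (q ^ I) + a2 * t ^ (q ^ J) + a3 * t ^ (q ^ (2 * I))
                 + a4 * t ^ (q ^ (I + J)) + a5 * t ^ (q ^ (2 * J)) = 0"
  shows "a5 = 0" and "a3 = 0 \<Longrightarrow> a1 = 0 \<and> a2 = 0"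
proof -
  define c where "c = (\<lambda>e. (if e = 0 then a0 else 0) + (if e = I then a1 else 0)
     + (if e = J then a2 else 0) + (if e = 2 * I then a3 else 0)
     + (if e = I + J then a4 else 0) + (if e = 2 * J then a5 else 0))"
  have delta: "(\<Sum>e<n. (if e = k then a else 0) * t ^ (q ^ e)) = a * t ^ (q ^ k)"
    if "k < n" for k and a t :: 'a
  proof -
    have "(\<Sum>e<n. (if e = k then a else 0) * t ^ (q ^ e)) = (\<Sum>e<n. if e = k then a * t ^ (q ^ e) else 0)"
      by (intro sum.cong) auto
    thus ?thesis using that by simp
  qed
  have "(\<Sum>e<n. c e * t ^ (q ^ e)) = 0" for t
    unfolding c_def distrib_right sum.distrib
    using zero[of t] assms(3-5) by (simp add: delta)
  hence c: "c e = 0" if "e < n" for e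
    using linearized_poly_eq_0_imp_coeff_eq_0[OF q card _ that] by blast
  show "a5 = 0"
    using c[of "2 * J"] assms(3-5) by (simp add: c_def)
  show "a1 = 0 \<and> a2 = 0" if "a3 = 0"
    using c[of I] c[of J] assms(3-5) that by (simp add: c_def split: if_splits)
qed

text \<open>The two brackets stand for coordinates \<open>i\<close> and \<open>i + 1\<close> of an
  image vector, the right-hand side for coordinate \<open>m + i\<close>. After expansion
  \<open>Q2'\<close> alone feeds the exponent \<open>2 * J\<close>; \<open>Q\<close> alone feeds
  \<open>2 * I\<close>, so \<open>Q = 0\<close> removes the term that could collide with
  \<open>J\<close>.\<close>

lemma coefficient_comparison:
  fixes P Q Q2 P' Q' Q2' b R S S2 :: "'a :: {field, finite}"
  assumes q: "primepow q" and card: "CARD('a) = q ^ n"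
    and IJ: "0 < I" "I < J" "2 * J < n"
    and eq: "\<And>t. (P * t + Q * t ^ (q ^ I) + Q2 * t ^ (q ^ J)) ^ (q ^ I)
                + b * (P' * t + Q' * t ^ (q ^ I) + Q2' * t ^ (q ^ J)) ^ (q ^ J)
              = R * t + S * t ^ (q ^ I) + S2 * t ^ (q ^ J)"
  shows "b * Q2' ^ (q ^ J) = 0"
    and "Q = 0 \<Longrightarrow> S = P ^ (q ^ I) \<and> S2 = b * P' ^ (q ^ J)"
proof -
  have q1: "q > 1"
    using primepow_gt_Suc_0[OF q] by simp
  have "- R * t + (P ^ (q ^ I) - S) * t ^ (q ^ I) + (b * P' ^ (q ^ J) - S2) * t ^ (q ^ J)
      + Q ^ (q ^ I) * t ^ (q ^ (2 * I)) + (Q2 ^ (q ^ I) + b * Q' ^ (q ^ J)) * t ^ (q ^ (I + J))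
      + b * Q2' ^ (q ^ J) * t ^ (q ^ (2 * J)) = 0" for t
  proof -
    have *: "(t ^ (q ^ i)) ^ (q ^ j) = t ^ (q ^ (i + j))" for i j
      by (simp add: power_add power_mult)
    show ?thesis
      using eq[of t]
      by (simp add: frobenius_add[OF q card] power_mult_distrib * algebra_simps flip: mult_2)
  qed
  note six = linearized_six_terms[OF q1 card IJ this]
  show "b * Q2' ^ (q ^ J) = 0"
    by (rule six(1))
  show "S = P ^ (q ^ I) \<and> S2 = b * P' ^ (q ^ J)" if "Q = 0"
    using six(2) that q1 by simp
qed

subsection \<open>The cyclic recursion along a diagonal\<close>

lemma recursion_telescope:
  fixes r c :: "nat \<Rightarrow> 'a :: comm_ring_1"
  assumes "\<And>j. j < s \<Longrightarrow> r j = c (Suc j) * r (Suc j) ^ (q ^ K)"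
  shows "r 0 = (\<Prod>j<s. c (Suc j) ^ (q ^ (j * K))) * r s ^ (q ^ (s * K))"
  using assms
proof (induction s)
  case (Suc s)
  have "r 0 = (\<Prod>j<s. c (Suc j) ^ (q ^ (j * K))) * (c (Suc s) * r (Suc s) ^ (q ^ K)) ^ (q ^ (s * K))"
    using Suc.IH Suc.prems by simp
  thus ?case
    by (simp add: power_mult_distrib power_add mult_ac flip: power_mult)
qed simp

text \<open>One full turn gives \<open>r 0 = C * r 0 ^ (q ^ (m * K))\<close> with \<open>C\<close>
  the product, so \<open>C\<close> is a power of \<open>inverse (r 0)\<close>. Conversely, a root of
  \<open>C\<close> supplies a starting value for which the recursion closes up.\<close>

lemma periodic_recursion_solvable_iff:
  fixes c :: "nat \<Rightarrow> 'a :: field"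
  assumes q: "q > 1" and "m > 0" and "K > 0"
    and c0: "\<And>j. c j \<noteq> 0" and cper: "\<And>j. c (j + m) = c j"
  shows "(\<exists>r. \<forall>j. r j \<noteq> 0 \<and> r (j + m) = r j \<and> r j = c (Suc j) * r (Suc j) ^ (q ^ K)) \<longleftrightarrow>
         is_nth_power (q ^ (m * K) - 1) (\<Prod>j<m. c (Suc j) ^ (q ^ (j * K)))"
    (is "?L \<longleftrightarrow> is_nth_power ?N ?C")
proof
  have N: "?N > 0"
    using one_less_power[OF q, of "m * K"] assms(2,3) by simp
  have pow: "y ^ (q ^ (m * K)) = y * y ^ ?N" for y :: 'a
    using q by (simp flip: power_Suc)
  {
    assume ?L
    then obtain r where r0: "r 0 \<noteq> 0" and per: "\<And>j. r (j + m) = r j"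
      and rec: "\<And>j. r j = c (Suc j) * r (Suc j) ^ (q ^ K)" by blast
    have "r 0 = ?C * r m ^ (q ^ (m * K))"
      by (rule recursion_telescope) (rule rec)
    also have "r m = r 0"
      using per[of 0] by simp
    finally have "1 = ?C * r 0 ^ ?N"
      using r0 by (simp add: pow)
    hence "?C = inverse (r 0) ^ ?N"
      using r0 by (simp add: field_simps power_inverse)
    thus "is_nth_power ?N ?C" by (rule is_nth_powerI)
  }
  assume "is_nth_power ?N ?C"
  then obtain y where y: "?C = y ^ ?N" by (rule is_nth_powerE)
  have "?C \<noteq> 0" using c0 by simp
  hence y0: "y \<noteq> 0" using y N by (auto simp: power_0_left)
  \<comment> \<open>The recursion yields \<open>r j\<close> from \<open>r (Suc j)\<close> without
    extracting roots, so it is run downwards: \<open>T s\<close> plays the role of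
    \<open>r (m - s)\<close>, starting at \<open>r m = inverse y\<close>.\<close>
  define T where "T = rec_nat (inverse y) (\<lambda>s x. c (m - s) * x ^ (q ^ K))"
  have T_0: "T 0 = inverse y" and T_Suc: "T (Suc s) = c (m - s) * T s ^ (q ^ K)" for s
    by (simp_all add: T_def)
  have T_nz: "T s \<noteq> 0" for s
    by (induction s) (use y0 c0 in \<open>auto simp: T_0 T_Suc\<close>)
  have rec: "T (m - j) = c (Suc j) * T (m - Suc j) ^ (q ^ K)" if "j < m" for j
    using T_Suc[of "m - Suc j"] that by (simp add: Suc_diff_Suc)
  have "T (m - 0) = ?C * T (m - m) ^ (q ^ (m * K))"
    by (rule recursion_telescope) (rule rec)
  hence T_m: "T m = T 0"
    using y0 by (simp add: T_0 y pow power_inverse)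
  define r where "r j = T (m - j mod m)" for j
  have r_rec: "r j = c (Suc j) * r (Suc j) ^ (q ^ K)" for j
  proof -
    have cmod: "c (i + k * m) = c i" for i k
      by (induction k) (use cper in \<open>simp_all add: add.assoc[symmetric] add.commute[of m]\<close>)
    have "c (Suc j) = c (Suc (j mod m))"
      using cmod[of "Suc (j mod m)" "j div m"] by simp
    \<comment> \<open>At the end of a period \<open>r\<close> jumps to the value \<open>T m\<close>,
      which \<open>T_m\<close> identifies with the required \<open>T 0\<close>.\<close>
    moreover have "r (Suc j) = T (m - Suc (j mod m))"
      using T_m by (auto simp: r_def mod_Suc)
    ultimately show ?thesis
      using rec[of "j mod m"] \<open>m > 0\<close> by (simp add: r_def)
  qed
  have "r j \<noteq> 0 \<and> r (j + m) = r j" for j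
    using T_nz by (simp add: r_def)
  thus ?L
    using r_rec by blast
qed

subsection \<open>Monomial matrices\<close>

definition monomial_mat :: "nat \<Rightarrow> (nat \<Rightarrow> nat) \<Rightarrow> (nat \<Rightarrow> 'a :: field) \<Rightarrow> 'a mat" where
  "monomial_mat N \<pi> w = mat N N (\<lambda>(i, j). if i = \<pi> j then w j else 0)"

lemma monomial_mat_carrier [simp]: "monomial_mat N \<pi> w \<in> carrier_mat N N"
  by (simp add: monomial_mat_def)

text \<open>Reading the product at row \<open>\<pi> j\<close> avoids an inverse of
  \<open>\<pi>\<close>; injectivity leaves only the summand \<open>k = j\<close>.\<close>

lemma monomial_mat_mult_vec_index:
  assumes "inj_on \<pi> {..<N}" and "\<pi> j < N" and "j < N" and "v \<in> carrier_vec N"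
  shows "(monomial_mat N \<pi> w *\<^sub>v v) $ \<pi> j = w j * v $ j"
proof -
  have "(monomial_mat N \<pi> w *\<^sub>v v) $ \<pi> j = (\<Sum>k<N. (if \<pi> j = \<pi> k then w k else 0) * v $ k)"
    using assms by (simp add: monomial_mat_def scalar_prod_def atLeast0LessThan)
  also have "\<dots> = (\<Sum>k<N. if k = j then w k * v $ k else 0)"
    using assms by (intro sum.cong) (auto dest: inj_onD)
  finally show ?thesis
    using assms by simp
qed

lemma monomial_mat_invertible:
  assumes "inj_on \<pi> {..<N}" and "\<And>j. j < N \<Longrightarrow> \<pi> j < N" and "\<And>j. j < N \<Longrightarrow> w j \<noteq> 0"
  shows "invertible_mat (monomial_mat N \<pi> w)"
proof -
  \<comment> \<open>The inverse has the transposed pattern and inverted weights; for square matrices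
    a left inverse suffices.\<close>
  define B where "B = mat N N (\<lambda>(j, i). if i = \<pi> j then inverse (w j) else 0)"
  have B: "B \<in> carrier_mat N N" by (simp add: B_def)
  have "B * monomial_mat N \<pi> w = 1\<^sub>m N"
  proof (rule eq_matI)
    fix j k assume "j < dim_row (1\<^sub>m N)" "k < dim_col (1\<^sub>m N)"
    hence jk: "j < N" "k < N" by auto
    have "(B * monomial_mat N \<pi> w) $$ (j, k)
        = (\<Sum>i<N. (if i = \<pi> j then inverse (w j) else 0) * (if i = \<pi> k then w k else 0))"
      using jk by (simp add: B_def monomial_mat_def scalar_prod_def atLeast0LessThan)
    also have "\<dots> = (\<Sum>i<N. if i = \<pi> j then (if \<pi> j = \<pi> k then inverse (w j) * w k else 0) else 0)"
      by (intro sum.cong) auto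
    also have "\<dots> = (if j = k then 1 else 0)"
      using assms jk by (auto dest: inj_onD)
    finally show "(B * monomial_mat N \<pi> w) $$ (j, k) = 1\<^sub>m N $$ (j, k)"
      using jk by simp
  qed (simp_all add: B_def monomial_mat_def)
  moreover from this have "monomial_mat N \<pi> w * B = 1\<^sub>m N"
    by (rule mat_mult_left_right_inverse[OF B monomial_mat_carrier])
  ultimately show ?thesis
    using B by (auto simp: invertible_mat_def inverts_mat_def monomial_mat_def)
qed

subsection \<open>Linear equivalences between the spaces\<close>

lemma Suc_mod_inj: "j < m \<Longrightarrow> l < m \<Longrightarrow> Suc j mod m = Suc l mod m \<longleftrightarrow> j = l"
  by (auto simp: mod_Suc split: if_splits)

lemma f_comp_Suc:
  "f_comp q m I J \<alpha> x (Suc k) = x (Suc k) ^ (q ^ I) + \<alpha> (Suc (Suc k mod m)) * x (Suc (Suc k mod m)) ^ (q ^ J)"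
  by (simp add: f_comp_def cyc_def)

lemma mult_mat_append_vec_index:
  assumes "M \<in> carrier_mat (2 * m) (2 * m)" and "i < 2 * m"
  shows "(M *\<^sub>v (vec m a @\<^sub>v vec m b)) $ i = (\<Sum>j<m. M $$ (i, j) * a j) + (\<Sum>j<m. M $$ (i, m + j) * b j)"
proof -
  have "(M *\<^sub>v (vec m a @\<^sub>v vec m b)) $ i =
      (\<Sum>j<m + m. M $$ (i, j) * (if j < m then a j else b (j - m)))"
    using assms by (auto simp: scalar_prod_def atLeast0LessThan intro!: sum.cong)
  also have "{..<m + m} = {..<m} \<union> (+) m ` {..<m}"
    using image_add_atLeastLessThan[of m 0 m] by (auto simp flip: lessThan_atLeast0)
  also have "(\<Sum>j\<in>\<dots>. M $$ (i, j) * (if j < m then a j else b (j - m))) =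
      (\<Sum>j<m. M $$ (i, j) * a j) + (\<Sum>j<m. M $$ (i, m + j) * b j)"
    by (subst sum.union_disjoint) (auto simp: sum.reindex)
  finally show ?thesis .
qed

text \<open>Tests the inclusion on \<open>x = t e_k\<close>. The column \<open>k\<close> is given
  through its cyclic predecessor \<open>l\<close>, because \<open>x_k\<close> enters exactly the
  components \<open>f_k\<close> and \<open>f_l\<close>. Here \<open>h s t\<close> is coordinate
  \<open>s\<close> of the image, and membership in the target space ties the lower coordinates to
  the upper ones.\<close>

lemma U_space_mult_eq:
  assumes M: "M \<in> carrier_mat (2 * m) (2 * m)"
    and U: "\<And>v. v \<in> U_space q m I J \<alpha> \<Longrightarrow> M *\<^sub>v v \<in> U_space q m I J \<alpha>'"
    and i: "i < m" and l: "l < m"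
  defines "k \<equiv> Suc l mod m" and "i' \<equiv> Suc i mod m"
  defines "h \<equiv> \<lambda>i t. M $$ (i, k) * t + M $$ (i, m + k) * t ^ (q ^ I)
                       + (M $$ (i, m + l) * \<alpha> (Suc k)) * t ^ (q ^ J)"
  assumes q: "q > 0"
  shows "h i t ^ (q ^ I) + \<alpha>' (Suc i') * h i' t ^ (q ^ J) = h (m + i) t"
proof -
  have k: "k < m" and i': "i' < m"
    using i by (auto simp: k_def i'_def)
  define x where "x j = (if j = Suc k then t else 0)" for j
  define v where "v = vec m (\<lambda>k. x (k + 1)) @\<^sub>v vec m (\<lambda>k. f_comp q m I J \<alpha> x (k + 1))"
  have h: "(M *\<^sub>v v) $ s = h s t" if s: "s < 2 * m" for s
  proof -
    have "(\<Sum>j<m. M $$ (s, j) * x (j + 1)) = (\<Sum>j<m. if j = k then M $$ (s, j) * t else 0)"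
      by (intro sum.cong) (auto simp: x_def)
    moreover have "(\<Sum>j<m. M $$ (s, m + j) * f_comp q m I J \<alpha> x (j + 1)) =
       (\<Sum>j<m. (if j = k then M $$ (s, m + j) * t ^ (q ^ I) else 0)
         + (if j = l then M $$ (s, m + j) * \<alpha> (Suc k) * t ^ (q ^ J) else 0))"
      using q l by (intro sum.cong) (auto simp: x_def f_comp_Suc k_def Suc_mod_inj power_0_left algebra_simps)
    ultimately show ?thesis
      using k l by (simp add: v_def mult_mat_append_vec_index[OF M s] h_def sum.distrib algebra_simps)
  qed
  have "v \<in> U_space q m I J \<alpha>"
    by (auto simp: v_def U_space_def)
  from U[OF this] obtain y where
    y: "M *\<^sub>v v = vec m (\<lambda>k. y (k + 1)) @\<^sub>v vec m (\<lambda>k. f_comp q m I J \<alpha>' y (k + 1))"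
    by (auto simp: U_space_def)
  have y1: "y (Suc s) = h s t" if "s < m" for s
    using h[of s] that by (simp add: y)
  have "h (m + i) t = f_comp q m I J \<alpha>' y (i + 1)"
    using h[of "m + i"] i by (simp add: y)
  thus ?thesis
    using i i' by (simp add: f_comp_Suc y1 flip: i'_def)
qed

lemma invertible_mat_row_nonzero:
  assumes "(M :: 'a :: field mat) \<in> carrier_mat N N" and "invertible_mat M" and "i < N"
  obtains j where "j < N" and "M $$ (i, j) \<noteq> 0"
proof -
  obtain B where B: "M * B = 1\<^sub>m N" "B * M = 1\<^sub>m (dim_row B)"
    using assms(1,2) by (auto simp: invertible_mat_def inverts_mat_def)
  have dimB: "dim_col B = N" "dim_row B = N"
    using arg_cong[OF B(1), of dim_col] arg_cong[OF B(2), of dim_col] assms(1) by auto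
  have "(\<Sum>j<N. M $$ (i, j) * B $$ (j, i)) = (M * B) $$ (i, i)"
    using assms dimB by (simp add: scalar_prod_def atLeast0LessThan)
  also have "\<dots> \<noteq> 0"
    using assms(3) by (simp add: B(1))
  finally obtain j where "j < N" "M $$ (i, j) * B $$ (j, i) \<noteq> 0"
    by (meson lessThan_iff sum.neutral)
  thus ?thesis
    using that by auto
qed

text \<open>
  With indices starting at \<open>0\<close> and read modulo \<open>m\<close>, \<open>p j\<close> is the entry of \<open>P\<close> in row \<open>j + d\<close> and
  column \<open>j\<close>; the diagonal \<open>d\<close> corresponds to \<open>\<delta> = d + 1\<close>.
\<close>

definition diagonal_solution ::
  "nat \<Rightarrow> nat \<Rightarrow> nat \<Rightarrow> nat \<Rightarrow> (nat \<Rightarrow> 'a :: field) \<Rightarrow> (nat \<Rightarrow> 'a) \<Rightarrow> nat \<Rightarrow> (nat \<Rightarrow> 'a) \<Rightarrow> bool" where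
  "diagonal_solution q m I J \<alpha> \<alpha>' d p \<longleftrightarrow>
     (\<forall>j. p j \<noteq> 0 \<and> p (j + m) = p j \<and>
        \<alpha>' (Suc (Suc (j + d) mod m)) * p (Suc j) ^ (q ^ J) = \<alpha> (Suc (Suc j mod m)) * p j ^ (q ^ I))"

text \<open>Once \<open>Q = 0\<close>, invertibility puts a nonzero entry of row \<open>0\<close>
  into the block \<open>P\<close>, and the equations for \<open>P\<close> spread nonvanishing along
  the cyclic diagonal through it.\<close>

lemma U_space_equiv_imp_diagonal_solution:
  fixes \<alpha> \<alpha>' :: "nat \<Rightarrow> 'a :: {field, finite}"
  assumes q: "primepow q" and card: "CARD('a) = q ^ n"
    and IJ: "0 < I" "I < J" "2 * J < n" and m: "m > 0"
    and \<alpha>: "\<And>i. i \<in> {1..m} \<Longrightarrow> \<alpha> i \<noteq> 0" and \<alpha>': "\<And>i. i \<in> {1..m} \<Longrightarrow> \<alpha>' i \<noteq> 0"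
    and M: "M \<in> carrier_mat (2 * m) (2 * m)" and inv: "invertible_mat M"
    and U: "\<And>v. v \<in> U_space q m I J \<alpha> \<Longrightarrow> M *\<^sub>v v \<in> U_space q m I J \<alpha>'"
  obtains d p where "d < m" and "diagonal_solution q m I J \<alpha> \<alpha>' d p"
proof -
  have q0: "q > 0"
    using primepow_gt_0_nat[OF q] .
  have \<alpha>1: "\<alpha> (Suc (j mod m)) \<noteq> 0" and \<alpha>'1: "\<alpha>' (Suc (j mod m)) \<noteq> 0" for j
    using \<alpha>[of "Suc (j mod m)"] \<alpha>'[of "Suc (j mod m)"] m by (auto simp: Suc_le_eq)
  note cmp = coefficient_comparison[OF q card IJ U_space_mult_eq[where \<alpha> = \<alpha> and \<alpha>' = \<alpha>', OF M U _ _ q0]]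
  have Q_Suc: "M $$ (Suc i mod m, m + l) = 0" if "i < m" "l < m" for i l
    using cmp(1)[OF _ that] \<alpha>1[of "Suc l"] \<alpha>'1[of "Suc i"] by simp
  have Q: "M $$ (i, m + l) = 0" if "i < m" "l < m" for i l
  proof -
    \<comment> \<open>Every index is a cyclic successor, so \<open>Q_Suc\<close> reaches all rows;
      adding \<open>m\<close> first keeps the subtraction from truncating at
      \<open>i = 0\<close>.\<close>
    have "i = Suc ((i + m - 1) mod m) mod m"
      using that m by (simp add: mod_Suc_eq)
    thus ?thesis
      using Q_Suc[of "(i + m - 1) mod m" l] that m by simp
  qed
  have S: "M $$ (m + i, m + Suc l mod m) = M $$ (i, Suc l mod m) ^ (q ^ I)"
    and S2: "M $$ (m + i, m + l) * \<alpha> (Suc (Suc l mod m)) =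
             \<alpha>' (Suc (Suc i mod m)) * M $$ (Suc i mod m, Suc l mod m) ^ (q ^ J)"
    if "i < m" "l < m" for i l
    using cmp(2)[OF _ that] Q[of i "Suc l mod m"] that m by auto
  have S': "M $$ (m + i, m + l) = M $$ (i, l) ^ (q ^ I)" if "i < m" "l < m" for i l
  proof -
    have "l = Suc ((l + m - 1) mod m) mod m"
      using that m by (simp add: mod_Suc_eq)
    thus ?thesis
      using S[of i "(l + m - 1) mod m"] that m by simp
  qed
  \<comment> \<open>Eliminating the block \<open>S\<close> leaves equations in \<open>P\<close>
    alone, each linking an entry to its diagonal neighbour.\<close>
  have P: "\<alpha>' (Suc (Suc i mod m)) * M $$ (Suc i mod m, Suc l mod m) ^ (q ^ J) =
           \<alpha> (Suc (Suc l mod m)) * M $$ (i, l) ^ (q ^ I)" if "i < m" "l < m" for i l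
    using S2[OF that] S'[OF that] by (simp add: mult.commute)
  obtain j0 where j0: "j0 < 2 * m" "M $$ (0, j0) \<noteq> 0"
    by (rule invertible_mat_row_nonzero[OF M inv, of 0]) (use m in auto)
  have j0m: "j0 < m"
  proof (rule ccontr)
    assume "\<not> j0 < m"
    hence "j0 - m < m" and "m + (j0 - m) = j0"
      using j0(1) by auto
    thus False
      using Q[of 0 "j0 - m"] j0(2) m by simp
  qed
  \<comment> \<open>Chosen so that \<open>p j0\<close> is the nonzero entry in row \<open>0\<close>;
    the reduction modulo \<open>m\<close> gives \<open>d = 0\<close> when
    \<open>j0 = 0\<close>.\<close>
  define d where "d = (m - j0) mod m"
  define p where "p j = M $$ ((j + d) mod m, j mod m)" for j
  have rec: "\<alpha>' (Suc (Suc (j + d) mod m)) * p (Suc j) ^ (q ^ J) = \<alpha> (Suc (Suc j mod m)) * p j ^ (q ^ I)" for j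
    using P[of "(j + d) mod m" "j mod m"] m by (simp add: p_def mod_Suc_eq)
  have per: "p (j + m) = p j" for j
  proof -
    have "(j + m + d) mod m = (j + d) mod m"
      by (metis add.assoc add.commute mod_add_self2)
    thus ?thesis by (simp add: p_def)
  qed
  have nz: "p (j0 + s) \<noteq> 0" for s
  proof (induction s)
    case 0
    have "(j0 + d) mod m = 0"
      using j0m by (simp add: d_def mod_add_right_eq)
    thus ?case
      using j0 j0m by (simp add: p_def)
  next
    case (Suc s)
    thus ?case
      using rec[of "j0 + s"] \<alpha>1[of "Suc (j0 + s)"] q0 by (auto simp: power_0_left)
  qed
  have "p j \<noteq> 0" for j
  proof -
    have "p (j + s * m) = p j" for s
      by (induction s) (use per in \<open>simp_all add: add.assoc[symmetric] add.commute[of m]\<close>)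
    \<comment> \<open>Nonvanishing is known only from \<open>j0\<close> onwards; \<open>j0\<close>
      full periods carry any \<open>j\<close> into that range.\<close>
    moreover have "j + j0 * m = j0 + (j + j0 * (m - 1))"
      using m by (cases m) auto
    ultimately show ?thesis
      using nz by metis
  qed
  hence "diagonal_solution q m I J \<alpha> \<alpha>' d p"
    using rec per by (simp add: diagonal_solution_def)
  thus ?thesis
    using that[of d p] m by (simp add: d_def)
qed

text \<open>Under \<open>y_(j+d) = p_j x_j\<close> the diagonal equation makes both terms of
  \<open>f_(j+d)(y)\<close> acquire the same factor \<open>p_j ^ (q ^ I)\<close>, so a monomial
  matrix maps one space onto the other.\<close>

lemma diagonal_solution_imp_U_space_equiv:
  fixes \<alpha> \<alpha>' :: "nat \<Rightarrow> 'a :: field"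
  assumes m: "m > 0" and sol: "diagonal_solution q m I J \<alpha> \<alpha>' d p"
  obtains M where "M \<in> carrier_mat (2 * m) (2 * m)" and "invertible_mat M"
    and "U_space q m I J \<alpha>' = (*\<^sub>v) M ` U_space q m I J \<alpha>"
proof -
  define \<pi> where "\<pi> j = (if j < m then (j + d) mod m else m + (j - m + d) mod m)" for j
  define w where "w j = (if j < m then p j else p (j - m) ^ (q ^ I))" for j
  define M where "M = monomial_mat (2 * m) \<pi> w"
  have \<pi>_less: "\<pi> j < 2 * m" for j
    using m by (auto simp: \<pi>_def intro: less_le_trans[OF mod_less_divisor])
  have shift_inj: "i = j" if "(i + d) mod m = (j + d) mod m" "i < m" "j < m" for i j
    using that by (metis cong_add_rcancel_nat cong_def mod_less)
  have inj: "inj_on \<pi> {..<2 * m}"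
  proof (rule inj_onI)
    fix i j assume *: "i \<in> {..<2 * m}" "j \<in> {..<2 * m}" "\<pi> i = \<pi> j"
    have "\<pi> k < m \<longleftrightarrow> k < m" for k
      using m by (simp add: \<pi>_def)
    hence same: "i < m \<longleftrightarrow> j < m"
      using *(3) by metis
    show "i = j"
    proof (cases "i < m")
      case True
      thus ?thesis
        using * same shift_inj[of i j] by (simp add: \<pi>_def)
    next
      case False
      hence "i - m = j - m"
        using * same by (intro shift_inj[of "i - m" "j - m"]) (simp_all add: \<pi>_def)
      thus ?thesis
        using False same by simp
    qed
  qed
  \<comment> \<open>Allows vectors to be compared only at coordinates of the form
    \<open>\<pi> j\<close>.\<close>
  have surj: "\<pi> ` {..<2 * m} = {..<2 * m}"
    by (rule endo_inj_surj) (use \<pi>_less inj in auto)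
  have p0: "p j \<noteq> 0" and per: "p (j + m) = p j"
    and rec: "\<alpha>' (Suc (Suc (j + d) mod m)) * p (Suc j) ^ (q ^ J) = \<alpha> (Suc (Suc j mod m)) * p j ^ (q ^ I)" for j
    using sol by (auto simp: diagonal_solution_def)
  let ?u = "\<lambda>\<alpha> x. vec m (\<lambda>k. x (k + 1)) @\<^sub>v vec m (\<lambda>k. f_comp q m I J \<alpha> x (k + 1))"
  \<comment> \<open>The premise \<open>xy\<close> is the change of variables; the two inclusions
    below solve it for \<open>x\<close> and for \<open>y\<close>.\<close>
  have image: "M *\<^sub>v ?u \<alpha> x = ?u \<alpha>' y"
    if xy: "\<And>j. j < m \<Longrightarrow> y (Suc ((j + d) mod m)) = p j * x (Suc j)" for x y
  proof (rule eq_vecI)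
    fix i assume "i < dim_vec (?u \<alpha>' y)"
    hence "i \<in> \<pi> ` {..<2 * m}"
      unfolding surj by simp
    then obtain j where j: "j < 2 * m" "i = \<pi> j"
      by auto
    have "?u \<alpha> x \<in> carrier_vec (2 * m)"
      unfolding mult_2 by (intro append_carrier_vec vec_carrier)
    from monomial_mat_mult_vec_index[OF inj \<pi>_less j(1) this]
    have "(M *\<^sub>v ?u \<alpha> x) $ i = w j * ?u \<alpha> x $ j"
      by (simp add: M_def j(2))
    also have "\<dots> = ?u \<alpha>' y $ i"
    proof (cases "j < m")
      case True
      thus ?thesis
        using m by (simp add: j(2) \<pi>_def w_def xy trans_less_add1)
    next
      case False
      define l where "l = j - m"
      have l: "l < m" "j = m + l"
        using False j(1) by (auto simp: l_def)
      have p_mod: "p (Suc l mod m) = p (Suc l)"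
        using l per[of 0] by (auto simp: mod_Suc)
      have "y (Suc (Suc (l + d) mod m)) = y (Suc ((Suc l mod m + d) mod m))"
        by (simp add: mod_add_left_eq)
      also have "\<dots> = p (Suc l) * x (Suc (Suc l mod m))"
        using xy[of "Suc l mod m"] m by (simp add: p_mod)
      finally have "f_comp q m I J \<alpha>' y (Suc ((l + d) mod m)) = p l ^ (q ^ I) * f_comp q m I J \<alpha> x (Suc l)"
        using l xy[of l] rec[of l]
        by (simp add: f_comp_Suc mod_Suc_eq power_mult_distrib algebra_simps)
      thus ?thesis
        using m l by (simp add: j(2) \<pi>_def w_def)
    qed
    finally show "(M *\<^sub>v ?u \<alpha> x) $ i = ?u \<alpha>' y $ i" .
  qed (simp add: M_def monomial_mat_def)
  have "U_space q m I J \<alpha>' = (*\<^sub>v) M ` U_space q m I J \<alpha>"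
  proof (intro equalityI subsetI)
    fix u assume "u \<in> U_space q m I J \<alpha>'"
    then obtain y where u: "u = ?u \<alpha>' y" by (auto simp: U_space_def)
    define x where "x j = y (Suc ((j - 1 + d) mod m)) / p (j - 1)" for j
    have "M *\<^sub>v ?u \<alpha> x = u"
      unfolding u by (rule image) (use p0 in \<open>simp add: x_def\<close>)
    thus "u \<in> (*\<^sub>v) M ` U_space q m I J \<alpha>"
      by (auto simp: U_space_def)
  next
    fix u assume "u \<in> (*\<^sub>v) M ` U_space q m I J \<alpha>"
    then obtain x where u: "u = M *\<^sub>v ?u \<alpha> x" by (auto simp: U_space_def)
    \<comment> \<open>Inverts the cyclic shift, so that \<open>y\<close> can be written in terms of
      \<open>x\<close>.\<close>
    define g where "g = inv_into {..<m} (\<lambda>j. (j + d) mod m)"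
    have "inj_on (\<lambda>j. (j + d) mod m) {..<m}"
      using shift_inj by (auto intro: inj_onI)
    from inv_into_f_f[OF this] have g: "g ((j + d) mod m) = j" if "j < m" for j
      using that by (simp add: g_def)
    define y where "y i = p (g (i - 1)) * x (Suc (g (i - 1)))" for i
    have "u = ?u \<alpha>' y"
      unfolding u by (rule image) (simp add: y_def g)
    thus "u \<in> U_space q m I J \<alpha>'"
      by (auto simp: U_space_def)
  qed
  moreover have "invertible_mat M"
    unfolding M_def by (rule monomial_mat_invertible[OF inj]) (use \<pi>_less p0 in \<open>auto simp: w_def\<close>)
  ultimately show ?thesis
    using that[of M] by (simp add: M_def)
qed

section \<open>The power condition for a single diagonal\<close>

text \<open>Passing to \<open>r j = p j ^ (q ^ I)\<close> turns the exponents \<open>q ^ J\<close>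
  and \<open>q ^ I\<close> into \<open>q ^ (J - I)\<close> and \<open>1\<close>, which is the
  periodic recursion with ratios \<open>c\<close>.\<close>

lemma diagonal_solution_iff_nth_power:
  fixes \<alpha> \<alpha>' :: "nat \<Rightarrow> 'a :: {field, finite}"
  assumes q: "primepow q" and card: "CARD('a) = q ^ n"
    and IJ: "I < J" and m: "m > 0"
    and \<alpha>: "\<And>i. i \<in> {1..m} \<Longrightarrow> \<alpha> i \<noteq> 0" and \<alpha>': "\<And>i. i \<in> {1..m} \<Longrightarrow> \<alpha>' i \<noteq> 0"
  shows "(\<exists>p. diagonal_solution q m I J \<alpha> \<alpha>' d p) \<longleftrightarrow>
         is_nth_power (q ^ (m * (J - I)) - 1) (C_coeff q m (J - I) \<alpha> \<alpha>' (\<lambda>x. x) (Suc d))"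
proof -
  define c where "c j = \<alpha>' (Suc ((j + d) mod m)) / \<alpha> (Suc (j mod m))" for j
  have \<alpha>1: "\<alpha> (Suc (j mod m)) \<noteq> 0" and \<alpha>'1: "\<alpha>' (Suc (j mod m)) \<noteq> 0" for j
    using \<alpha>[of "Suc (j mod m)"] \<alpha>'[of "Suc (j mod m)"] m by (auto simp: Suc_le_eq)
  have q1: "q > 1"
    using primepow_gt_Suc_0[OF q] by simp
  have c_per: "c (j + m) = c j" for j
  proof -
    have "(j + m + d) mod m = (j + d) mod m"
      by (metis add.assoc add.commute mod_add_self2)
    thus ?thesis by (simp add: c_def)
  qed
  have C: "C_coeff q m (J - I) \<alpha> \<alpha>' (\<lambda>x. x) (Suc d) = (\<Prod>j<m. c (Suc j) ^ (q ^ (j * (J - I))))"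
    by (simp add: C_coeff_def c_def cyc_def add_ac)
  have pow: "x ^ (q ^ J) = (x ^ (q ^ I)) ^ (q ^ (J - I))" for x :: 'a
    using IJ by (simp flip: power_mult power_add)
  have rec_iff: "\<alpha>' (Suc (Suc (j + d) mod m)) * y ^ (q ^ J) = \<alpha> (Suc (Suc j mod m)) * x ^ (q ^ I)
      \<longleftrightarrow> x ^ (q ^ I) = c (Suc j) * (y ^ (q ^ I)) ^ (q ^ (J - I))" for j x y
    using \<alpha>1[of "Suc j"] by (auto simp: c_def pow field_simps)
  have "(\<exists>p. diagonal_solution q m I J \<alpha> \<alpha>' d p) \<longleftrightarrow>
     (\<exists>r. \<forall>j. r j \<noteq> 0 \<and> r (j + m) = r j \<and> r j = c (Suc j) * r (Suc j) ^ (q ^ (J - I)))"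
  proof
    assume "\<exists>p. diagonal_solution q m I J \<alpha> \<alpha>' d p"
    then obtain p where "p j \<noteq> 0" "p (j + m) = p j"
        "p j ^ (q ^ I) = c (Suc j) * (p (Suc j) ^ (q ^ I)) ^ (q ^ (J - I))" for j
      unfolding diagonal_solution_def rec_iff by blast
    thus "\<exists>r. \<forall>j. r j \<noteq> 0 \<and> r (j + m) = r j \<and> r j = c (Suc j) * r (Suc j) ^ (q ^ (J - I))"
      by (intro exI[of _ "\<lambda>j. p j ^ (q ^ I)"] allI conjI power_not_zero arg_cong[of _ _ "\<lambda>x. x ^ _"])
  next
    assume "\<exists>r. \<forall>j. r j \<noteq> 0 \<and> r (j + m) = r j \<and> r j = c (Suc j) * r (Suc j) ^ (q ^ (J - I))"
    then obtain r where r: "r j \<noteq> 0" "r (j + m) = r j" "r j = c (Suc j) * r (Suc j) ^ (q ^ (J - I))" for j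
      by blast
    \<comment> \<open>Since one fixed root function is applied to all \<open>r j\<close>,
      periodicity carries over to the roots.\<close>
    define \<phi> where "\<phi> = inv_into UNIV (\<lambda>x::'a. x ^ (q ^ I))"
    have \<phi>: "\<phi> x ^ (q ^ I) = x" for x
      unfolding \<phi>_def by (rule surj_f_inv_f[OF frobenius_surj[OF q card]])
    have "\<alpha>' (Suc (Suc (j + d) mod m)) * \<phi> (r (Suc j)) ^ (q ^ J) = \<alpha> (Suc (Suc j mod m)) * \<phi> (r j) ^ (q ^ I)" for j
      unfolding rec_iff unfolding \<phi> by (rule r(3))
    moreover have "\<phi> (r j) \<noteq> 0" for j
      using \<phi>[of "r j"] r(1)[of j] q1 by (auto simp: power_0_left)
    ultimately have "diagonal_solution q m I J \<alpha> \<alpha>' d (\<lambda>j. \<phi> (r j))"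
      unfolding diagonal_solution_def using r(2) by simp
    thus "\<exists>p. diagonal_solution q m I J \<alpha> \<alpha>' d p"
      by blast
  qed
  also have "\<dots> \<longleftrightarrow> is_nth_power (q ^ (m * (J - I)) - 1) (\<Prod>j<m. c (Suc j) ^ (q ^ (j * (J - I))))"
    using IJ c_per \<alpha>1 \<alpha>'1
    by (intro periodic_recursion_solvable_iff q1 m) (auto simp: c_def)
  finally show ?thesis
    unfolding C .
qed

section \<open>Field automorphisms and the semilinear criterion\<close>

text \<open>An automorphism commutes with taking powers and permutes the parameters
  \<open>x\<close>, so only the coefficients change.\<close>

lemma map_vec_U_space:
  assumes "field_automorphism \<sigma>"
  shows "map_vec \<sigma> ` U_space q m I J \<alpha> = U_space q m I J (\<lambda>i. \<sigma> (\<alpha> i))"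
proof -
  interpret field_hom \<sigma>
    using assms by (simp add: field_automorphism_def)
  have surj: "surj \<sigma>"
    using assms by (simp add: field_automorphism_def bij_is_surj)
  let ?u = "\<lambda>\<alpha> x. vec m (\<lambda>k. x (k + 1)) @\<^sub>v vec m (\<lambda>k. f_comp q m I J \<alpha> x (k + 1))"
  have map_u: "map_vec \<sigma> (?u \<alpha> x) = ?u (\<lambda>i. \<sigma> (\<alpha> i)) (\<lambda>i. \<sigma> (x i))" for x
    by (rule eq_vecI) (auto simp: f_comp_def hom_distribs)
  have "?u (\<lambda>i. \<sigma> (\<alpha> i)) y \<in> map_vec \<sigma> ` U_space q m I J \<alpha>" for y
  proof -
    have "?u (\<lambda>i. \<sigma> (\<alpha> i)) y = map_vec \<sigma> (?u \<alpha> (\<lambda>i. inv_into UNIV \<sigma> (y i)))"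
      using map_u[of "\<lambda>i. inv_into UNIV \<sigma> (y i)"] by (simp add: surj_f_inv_f[OF surj])
    thus ?thesis
      by (auto simp: U_space_def)
  qed
  thus ?thesis
    using map_u by (force simp: U_space_def)
qed

lemma C_coeff_twist: "C_coeff q m K \<alpha> \<alpha>' \<sigma> \<delta> = C_coeff q m K (\<lambda>i. \<sigma> (\<alpha> i)) \<alpha>' (\<lambda>x. x) \<delta>"
  by (simp add: C_coeff_def)

theorem mainTheorem12:
  fixes q n m I J K :: nat
    and \<alpha> \<alpha>' :: "nat \<Rightarrow> 'a :: {field, finite}"
  assumes "primepow q"
    and "n > 0"
    and "CARD('a) = q ^ n"
    and "m \<ge> 3"
    and "0 < I" and "I < J" and "real J < real n / 2"
    and "gcd I J = 1"
    and "K = J - I"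
    and "\<And>i. i \<in> {1..m} \<Longrightarrow> \<alpha> i \<noteq> 0"
    and "\<And>i. i \<in> {1..m} \<Longrightarrow> \<alpha>' i \<noteq> 0"
  shows "GammaL_equiv (2 * m) (U_space q m I J \<alpha>) (U_space q m I J \<alpha>') \<longleftrightarrow>
         (\<exists>\<sigma>. field_automorphism \<sigma> \<and>
              (\<exists>\<delta>\<in>{1..m}. is_nth_power (q ^ (m * K) - 1) (C_coeff q m K \<alpha> \<alpha>' \<sigma> \<delta>)))"
proof -
  have m: "m > 0" and n: "2 * J < n"
    using assms(4,7) by linarith+
  \<comment> \<open>For fixed \<open>\<sigma>\<close> the automorphism is absorbed into the
    coefficients of the source space, leaving a purely linear question.\<close>
  have twisted: "(\<exists>M. M \<in> carrier_mat (2 * m) (2 * m) \<and> invertible_mat M \<and>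
           U_space q m I J \<alpha>' = {M *\<^sub>v map_vec \<sigma> v | v. v \<in> U_space q m I J \<alpha>}) \<longleftrightarrow>
        (\<exists>\<delta>\<in>{1..m}. is_nth_power (q ^ (m * K) - 1) (C_coeff q m K \<alpha> \<alpha>' \<sigma> \<delta>))"
    if \<sigma>: "field_automorphism \<sigma>" for \<sigma>
  proof -
    interpret field_hom \<sigma>
      using \<sigma> by (simp add: field_automorphism_def)
    let ?\<beta> = "\<lambda>i. \<sigma> (\<alpha> i)"
    have \<beta>: "?\<beta> i \<noteq> 0" if "i \<in> {1..m}" for i
      using assms(10)[OF that] by simp
    have image: "{M *\<^sub>v map_vec \<sigma> v | v. v \<in> U_space q m I J \<alpha>} = (*\<^sub>v) M ` U_space q m I J ?\<beta>" for M
      unfolding map_vec_U_space[OF \<sigma>, symmetric] by auto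
    have "(\<exists>M. M \<in> carrier_mat (2 * m) (2 * m) \<and> invertible_mat M \<and>
             U_space q m I J \<alpha>' = (*\<^sub>v) M ` U_space q m I J ?\<beta>) \<longleftrightarrow>
          (\<exists>d<m. \<exists>p. diagonal_solution q m I J ?\<beta> \<alpha>' d p)" (is "?L \<longleftrightarrow> ?R")
    proof
      assume ?L
      then obtain M where M: "M \<in> carrier_mat (2 * m) (2 * m)" "invertible_mat M"
        and "U_space q m I J \<alpha>' = (*\<^sub>v) M ` U_space q m I J ?\<beta>" by blast
      hence "M *\<^sub>v v \<in> U_space q m I J \<alpha>'" if "v \<in> U_space q m I J ?\<beta>" for v
        using that by simp
      from U_space_equiv_imp_diagonal_solution[where \<alpha> = ?\<beta>, OF assms(1,3,5,6) n m \<beta> assms(11) M this]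
      show ?R by blast
    next
      assume ?R
      thus ?L
        using diagonal_solution_imp_U_space_equiv[OF m] by metis
    qed
    also have "\<dots> \<longleftrightarrow> (\<exists>d<m. is_nth_power (q ^ (m * K) - 1) (C_coeff q m K \<alpha> \<alpha>' \<sigma> (Suc d)))"
      using diagonal_solution_iff_nth_power[OF assms(1,3,6) m \<beta> assms(11)]
      unfolding C_coeff_twist[of _ _ _ \<alpha> _ \<sigma>] assms(9) by simp
    also have "\<dots> \<longleftrightarrow> (\<exists>\<delta>\<in>{1..m}. is_nth_power (q ^ (m * K) - 1) (C_coeff q m K \<alpha> \<alpha>' \<sigma> \<delta>))"
      unfolding image_Suc_lessThan[symmetric] by auto
    finally show ?thesis
      unfolding image .
  qed
  have swap: "(\<exists>M \<sigma>. A M \<and> B M \<and> C \<sigma> \<and> D M \<sigma>) \<longleftrightarrow> (\<exists>\<sigma>. C \<sigma> \<and> (\<exists>M. A M \<and> B M \<and> D M \<sigma>))"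
    for A B :: "'a mat \<Rightarrow> bool" and C :: "('a \<Rightarrow> 'a) \<Rightarrow> bool" and D
    by blast
  have "GammaL_equiv (2 * m) (U_space q m I J \<alpha>) (U_space q m I J \<alpha>') \<longleftrightarrow>
      (\<exists>\<sigma>. field_automorphism \<sigma> \<and> (\<exists>M. M \<in> carrier_mat (2 * m) (2 * m) \<and> invertible_mat M \<and>
           U_space q m I J \<alpha>' = {M *\<^sub>v map_vec \<sigma> v | v. v \<in> U_space q m I J \<alpha>}))"
    unfolding GammaL_equiv_def by (rule swap)
  also have "\<dots> \<longleftrightarrow> (\<exists>\<sigma>. field_automorphism \<sigma> \<and>
              (\<exists>\<delta>\<in>{1..m}. is_nth_power (q ^ (m * K) - 1) (C_coeff q m K \<alpha> \<alpha>' \<sigma> \<delta>)))"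
    by (intro ex_cong1 conj_cong refl twisted)
  finally show ?thesis .
qed

end
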